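(* Let $S=(V,F)$ be a triangular surface mesh without boundary and $h$ a function on $S$. Let $\Delta_A h(v)=\mathrm{Div}_A(\nabla_A h)(v)$, $v\in V$, be the approximating Laplace–Beltrami operator applied to $h$, extended piecewise linearly (linearly on each triangle) to $S$. Then $$\int_S\Delta_A h=0.$$
   Context: A triangular surface mesh $S=(V,F)$ in $\mathbb{R}^3$ has a finite list $V$ of vertices and a finite list $F$ of (consistently oriented) triangles. Approximate normal: for $v\in V$, with $T(v)$ the set of triangles containing $v$, $N_T$ the unit normal of $T$, $G_T$ the centroid of $T$, $$\omega_T=\frac{\|G_T-v\|^{-2}}{\sum_{\tilde T\in T(v)}\|G_{\tilde T}-v\|^{-2}},\qquad N_A(v)=\frac{\sum_{T\in T(v)}\omega_T N_T}{\left\|\sum_{T\in T(v)}\omega_T N_T\right\|}.$$ The approximate tangent plane is $TS_A(v)=\{w\in\mathbb{R}^3:w\perp N_A(v)\}$. Approximating gradient: let $v_1,\dots,v_n$ be the neighbors of $v$ (valence $n\ge5$), $\bar v_i=(v_i-v)-\langle v_i-v,N_A(v)\rangle N_A(v)=x_ie_1+y_ie_2$ for a fixed orthonormal basis $e_1,e_2$ of $TS_A(v)$. Let $\alpha,\beta\in\mathbb{R}^n$ with $\sum\alpha_i^2=\sum\beta_i^2=1$ each solve the system (written for $\alpha$) $\sum\alpha_ix_iy_i=\sum\alpha_ix_i^2=\sum\alpha_iy_i^2=0$, chosen so that the matrix below is invertible. Then $$\nabla_A h(v)=\begin{pmatrix}\sum_i\alpha_ix_i&\sum_i\alpha_iy_i\\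 \sum_i\beta_ix_i&\sum_i\beta_iy_i\end{pmatrix}^{-1}\begin{pmatrix}\sum_i\alpha_i(h(v_i)-h(v))\\ \sum_i\beta_i(h(v_i)-h(v))\end{pmatrix},$$ the pair $(a,b)$ being identified with $ae_1+be_2\in TS_A(v)\subset\mathbb{R}^3$; thus $\nabla_A h$ is a vector field on $V$. Outer normals: for every $v\in V$, the neighboring vertices of $v$ are $v_0,\dots,v_n$ with $v_0=v_n$, labeled counterclockwise about $N_A(v)$ (i.e. their projections $\bar v_j$ to $TS_A(v)$ form a polygon going once counterclockwise around the origin, consecutive ones spanning an angle in $(0,\pi)$), and $T_j$ is the triangle with vertices $v,v_j,v_{j+1}$. Let $w_1=(v_{j+1}-v_j)-\langle v_{j+1}-v_j,N_A(v_j)\rangle N_A(v_j)$ and $w_2=(v-v_j)-\langle v-v_j,N_A(v_j)\rangle N_A(v_j)$, and $$n(T_j,v_j)=\frac{\langle w_2,w_1\rangle w_1-\|w_1\|^2w_2}{\left\|\langle w_2,w_1\rangle w_1-\|w_1\|^2w_2\right\|}.$$ Similarly, $n(T_j,v_{j+1})$ is given by the same formula with $w_1,w_2$ replaced by the projections of $v_j-v_{j+1}$ and $v-v_{j+1}$ to the plane $N_A(v_{j+1})^\perp$. All these expressions are assumed to be well defined (nonzero denominators). Discrete divergence of a vector field $X:V\to\mathbb{R}^3$, with $|T|$ the area of $T$: $$\mathrm{Div}_A X(v)=\frac{1}{\sum_{k=0}^{n-1}|T_k|}\sum_{j=0}^{n-1}\frac{\|v_{j+1}-v_j\|}{6}\Big(2\langle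 X(v_j),n(T_j,v_j)\rangle+2\langle X(v_{j+1}),n(T_j,v_{j+1})\rangle+\langle X(v_j),n(T_j,v_{j+1})\rangle+\langle X(v_{j+1}),n(T_j,v_j)\rangle\Big).$$ *)

theory Defs
  imports "HOL-Analysis.Analysis"
begin

text \<open>Vertices are points of space. A face is a triple of vertices whose cyclic order is its
  orientation; every face is listed in exactly one of its three rotations.\<close>

type_synonym point = "real ^ 3"
type_synonym face = "point \<times> point \<times> point"

fun verts :: "face \<Rightarrow> point set" where
  "verts (a, b, c) = {a, b, c}"

fun oriented_edges :: "face \<Rightarrow> (point \<times> point) set" where
  "oriented_edges (a, b, c) = {(a, b), (b, c), (c, a)}"

text \<open>The last condition is consistency of the orientation: a directed edge belongs to at most one
  face, so an edge has at most two faces, which traverse it in opposite directions. The mesh is not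
  required to be free of self-intersections.\<close>

definition surface_mesh :: "point set \<Rightarrow> face set \<Rightarrow> bool" where
  "surface_mesh V F \<longleftrightarrow>
     finite V \<and> finite F \<and>
     (\<forall>T\<in>F. verts T \<subseteq> V \<and> \<not> collinear (verts T)) \<and>
     inj_on verts F \<and>
     (\<forall>T\<in>F. \<forall>T'\<in>F. T \<noteq> T' \<longrightarrow> oriented_edges T \<inter> oriented_edges T' = {})"

definition without_boundary :: "face set \<Rightarrow> bool" where
  "without_boundary F \<longleftrightarrow>
     (\<forall>T\<in>F. \<forall>a\<in>verts T. \<forall>b\<in>verts T. a \<noteq> b \<longrightarrow> (\<exists>T'\<in>F. T' \<noteq> T \<and> a \<in> verts T' \<and> b \<in> verts T'))"

definition star :: "face set \<Rightarrow> point \<Rightarrow> face set" where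
  "star F v = {T \<in> F. v \<in> verts T}"

definition neighbors :: "face set \<Rightarrow> point \<Rightarrow> point set" where
  "neighbors F v = (\<Union>T\<in>star F v. verts T) - {v}"

fun unit_normal :: "face \<Rightarrow> point" where
  "unit_normal (a, b, c) = sgn (cross3 (b - a) (c - a))"

fun centroid :: "face \<Rightarrow> point" where
  "centroid (a, b, c) = (1 / 3) *\<^sub>R (a + b + c)"

fun area :: "face \<Rightarrow> real" where
  "area (a, b, c) = norm (cross3 (b - a) (c - a)) / 2"

definition weight :: "face set \<Rightarrow> point \<Rightarrow> face \<Rightarrow> real" where
  "weight F v T = inverse ((norm (centroid T - v))\<^sup>2) /
     (\<Sum>T'\<in>star F v. inverse ((norm (centroid T' - v))\<^sup>2))"

definition weighted_normal :: "face set \<Rightarrow> point \<Rightarrow> point" where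
  "weighted_normal F v = (\<Sum>T\<in>star F v. weight F v T *\<^sub>R unit_normal T)"

definition normal_A :: "face set \<Rightarrow> point \<Rightarrow> point" where
  "normal_A F v = (1 / norm (weighted_normal F v)) *\<^sub>R weighted_normal F v"

definition tangent_plane_A :: "face set \<Rightarrow> point \<Rightarrow> point set" where
  "tangent_plane_A F v = {w. w \<bullet> normal_A F v = 0}"

definition proj_A :: "face set \<Rightarrow> point \<Rightarrow> point \<Rightarrow> point" where
  "proj_A F v u = u - (u \<bullet> normal_A F v) *\<^sub>R normal_A F v"

text \<open>The closed polygon \<open>p 0, \<dots>, p n = p 0\<close> in the plane orthogonal to the unit vector \<open>N\<close> goes once
  counterclockwise around the origin; \<open>\<theta> j\<close> and \<open>r j\<close> are polar coordinates with respect to a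
  positively oriented orthonormal basis of that plane.\<close>

definition ccw_once :: "point \<Rightarrow> nat \<Rightarrow> (nat \<Rightarrow> point) \<Rightarrow> bool" where
  "ccw_once N n p \<longleftrightarrow>
     (\<exists>f1 f2 r \<theta>.
        norm f1 = 1 \<and> norm f2 = 1 \<and> f1 \<bullet> f2 = 0 \<and> cross3 f1 f2 = N \<and>
        (\<forall>j\<le>n. r j > 0 \<and> p j = r j *\<^sub>R (cos (\<theta> j) *\<^sub>R f1 + sin (\<theta> j) *\<^sub>R f2)) \<and>
        (\<forall>j<n. 0 < \<theta> (Suc j) - \<theta> j \<and> \<theta> (Suc j) - \<theta> j < pi) \<and>
        \<theta> n = \<theta> 0 + 2 * pi)"

definition ring_labelling :: "face set \<Rightarrow> point \<Rightarrow> nat \<Rightarrow> (nat \<Rightarrow> point) \<Rightarrow> bool" where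
  "ring_labelling F v n nb \<longleftrightarrow>
     nb n = nb 0 \<and>
     bij_betw nb {..<n} (neighbors F v) \<and>
     verts ` star F v = (\<lambda>j. {v, nb j, nb (Suc j)}) ` {..<n} \<and>
     ccw_once (normal_A F v) n (\<lambda>j. proj_A F v (nb j - v))"

definition orthonormal_basis_A :: "face set \<Rightarrow> point \<Rightarrow> point \<Rightarrow> point \<Rightarrow> bool" where
  "orthonormal_basis_A F v e1 e2 \<longleftrightarrow>
     e1 \<in> tangent_plane_A F v \<and> e2 \<in> tangent_plane_A F v \<and>
     norm e1 = 1 \<and> norm e2 = 1 \<and> e1 \<bullet> e2 = 0"

definition coord :: "face set \<Rightarrow> point \<Rightarrow> (nat \<Rightarrow> point) \<Rightarrow> point \<Rightarrow> nat \<Rightarrow> real" where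
  "coord F v nb e i = proj_A F v (nb i - v) \<bullet> e"

definition gradient_coeffs ::
  "face set \<Rightarrow> point \<Rightarrow> nat \<Rightarrow> (nat \<Rightarrow> point) \<Rightarrow> point \<Rightarrow> point \<Rightarrow> (nat \<Rightarrow> real) \<Rightarrow> bool" where
  "gradient_coeffs F v n nb e1 e2 \<alpha> \<longleftrightarrow>
     (\<Sum>i=1..n. (\<alpha> i)\<^sup>2) = 1 \<and>
     (\<Sum>i=1..n. \<alpha> i * coord F v nb e1 i * coord F v nb e2 i) = 0 \<and>
     (\<Sum>i=1..n. \<alpha> i * (coord F v nb e1 i)\<^sup>2) = 0 \<and>
     (\<Sum>i=1..n. \<alpha> i * (coord F v nb e2 i)\<^sup>2) = 0"

definition gradient_matrix ::
  "face set \<Rightarrow> point \<Rightarrow> nat \<Rightarrow> (nat \<Rightarrow> point) \<Rightarrow> point \<Rightarrow> point \<Rightarrow> (nat \<Rightarrow> real) \<Rightarrow> (nat \<Rightarrow> real)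
    \<Rightarrow> real ^ 2 ^ 2" where
  "gradient_matrix F v n nb e1 e2 \<alpha> \<beta> =
     vector [vector [\<Sum>i=1..n. \<alpha> i * coord F v nb e1 i, \<Sum>i=1..n. \<alpha> i * coord F v nb e2 i],
             vector [\<Sum>i=1..n. \<beta> i * coord F v nb e1 i, \<Sum>i=1..n. \<beta> i * coord F v nb e2 i]]"

definition gradient_A ::
  "face set \<Rightarrow> (point \<Rightarrow> nat) \<Rightarrow> (point \<Rightarrow> nat \<Rightarrow> point) \<Rightarrow> (point \<Rightarrow> point) \<Rightarrow> (point \<Rightarrow> point)
    \<Rightarrow> (point \<Rightarrow> nat \<Rightarrow> real) \<Rightarrow> (point \<Rightarrow> nat \<Rightarrow> real) \<Rightarrow> (point \<Rightarrow> real) \<Rightarrow> point \<Rightarrow> point" where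
  "gradient_A F val nb e1 e2 \<alpha> \<beta> h v =
     (let g = matrix_inv (gradient_matrix F v (val v) (nb v) (e1 v) (e2 v) (\<alpha> v) (\<beta> v)) *v
              (vector [\<Sum>i=1..val v. \<alpha> v i * (h (nb v i) - h v),
                       \<Sum>i=1..val v. \<beta> v i * (h (nb v i) - h v)] :: real ^ 2)
      in (g $ 1) *\<^sub>R e1 v + (g $ 2) *\<^sub>R e2 v)"

text \<open>For the triangle with vertices \<open>v, a, b\<close>, the outer normal at \<open>a\<close> of its edge \<open>a b\<close>, with
  \<open>w1\<close> and \<open>w2\<close> the projections of \<open>b - a\<close> and \<open>v - a\<close> to the approximate tangent plane at \<open>a\<close>.\<close>

definition outer_vec :: "face set \<Rightarrow> point \<Rightarrow> point \<Rightarrow> point \<Rightarrow> point" where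
  "outer_vec F v a b =
     (let w1 = proj_A F a (b - a); w2 = proj_A F a (v - a)
      in (w2 \<bullet> w1) *\<^sub>R w1 - ((norm w1)\<^sup>2) *\<^sub>R w2)"

definition outer_normal :: "face set \<Rightarrow> point \<Rightarrow> point \<Rightarrow> point \<Rightarrow> point" where
  "outer_normal F v a b = (1 / norm (outer_vec F v a b)) *\<^sub>R outer_vec F v a b"

definition Div_A ::
  "face set \<Rightarrow> (point \<Rightarrow> nat) \<Rightarrow> (point \<Rightarrow> nat \<Rightarrow> point) \<Rightarrow> (point \<Rightarrow> point) \<Rightarrow> point \<Rightarrow> real" where
  "Div_A F val nb X v =
     1 / (\<Sum>k<val v. area (v, nb v k, nb v (Suc k))) *
     (\<Sum>j<val v.
        let a = nb v j; b = nb v (Suc j); na = outer_normal F v a b; nb' = outer_normal F v b a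
        in norm (b - a) / 6 *
           (2 * (X a \<bullet> na) + 2 * (X b \<bullet> nb') + X a \<bullet> nb' + X b \<bullet> na))"

definition laplace_A ::
  "face set \<Rightarrow> (point \<Rightarrow> nat) \<Rightarrow> (point \<Rightarrow> nat \<Rightarrow> point) \<Rightarrow> (point \<Rightarrow> point) \<Rightarrow> (point \<Rightarrow> point)
    \<Rightarrow> (point \<Rightarrow> nat \<Rightarrow> real) \<Rightarrow> (point \<Rightarrow> nat \<Rightarrow> real) \<Rightarrow> (point \<Rightarrow> real) \<Rightarrow> point \<Rightarrow> real" where
  "laplace_A F val nb e1 e2 \<alpha> \<beta> h = Div_A F val nb (gradient_A F val nb e1 e2 \<alpha> \<beta> h)"

text \<open>The piecewise linear extension of a function on the vertices is given face by face, since faces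
  may intersect outside their common vertices and edges. On a nondegenerate face the barycentric
  coordinates \<open>x, y, z\<close> of a point are unique.\<close>

fun linear_extension :: "(point \<Rightarrow> real) \<Rightarrow> face \<Rightarrow> point \<Rightarrow> real" where
  "linear_extension f (a, b, c) p =
     (THE q. \<exists>x y z. x + y + z = 1 \<and> p = x *\<^sub>R a + y *\<^sub>R b + z *\<^sub>R c \<and> q = x * f a + y * f b + z * f c)"

text \<open>The surface integral over a triangle: parametrize it affinely by the standard triangle; the
  area element is the norm of the cross product of the partial derivatives.\<close>

fun face_integral :: "face \<Rightarrow> (point \<Rightarrow> real) \<Rightarrow> real" where
  "face_integral (a, b, c) u =
     set_lebesgue_integral lborel {(s :: real, t :: real). 0 \<le> s \<and> 0 \<le> t \<and> s + t \<le> 1}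
       (\<lambda>(s, t). u (a + s *\<^sub>R (b - a) + t *\<^sub>R (c - a)) * norm (cross3 (b - a) (c - a)))"

definition surface_integral :: "face set \<Rightarrow> (face \<Rightarrow> point \<Rightarrow> real) \<Rightarrow> real" where
  "surface_integral F u = (\<Sum>T\<in>F. face_integral T (u T))"

end

theory Submission
  imports Defs
begin

text \<open>The integral of a piecewise linear function over a face is a third of the area times the sum of
  the values at the vertices, so the integral of \<open>Div_A X\<close> is a third of the sum over all \<open>v\<close> of the
  boundary terms in \<open>Div_A X v\<close>; the area factors cancel. Each boundary term splits into one part for
  each endpoint of the edge \<open>a b\<close> opposite to \<open>v\<close>; the part for \<open>a\<close> involves only the outer normal at
  \<open>a\<close>. Collecting these parts by \<open>a\<close> instead of \<open>v\<close>, the two faces at an edge \<open>a b\<close> contribute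
  opposite amounts: their third vertices lie on opposite sides of the edge when projected to the
  approximate tangent plane at \<open>a\<close>, because the ring of \<open>a\<close> is ordered counterclockwise.\<close>

section \<open>Areas of triangles\<close>

lemma area_rotate: "area (b, c, a) = area (a, b, c)"
proof -
  have "cross3 (c - b) (a - b) = cross3 (b - a) (c - a)"
    by (simp add: cross3_simps)
  then show ?thesis by simp
qed

lemma area_swap: "area (a, c, b) = area (a, b, c)"
proof -
  have "cross3 (c - a) (b - a) = - cross3 (b - a) (c - a)"
    by (simp add: cross3_simps)
  then show ?thesis by simp
qed

lemma noncollinear_distinct:
  assumes "\<not> collinear {a, b, c}"
  shows "a \<noteq> b" "a \<noteq> c" "b \<noteq> c"
  using assms by (auto simp: insert_commute)

text \<open>Needed because a ring labelling fixes the triangles at a vertex only as vertex sets. The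
  six orderings of three distinct vertices are generated by a rotation and a swap.\<close>

lemma area_eq_if_verts_eq:
  assumes "verts T = verts T'" and "\<not> collinear (verts T)"
  shows "area T = area T'"
proof -
  obtain a b c where T: "T = (a, b, c)" by (cases T) auto
  obtain x y z where T': "T' = (x, y, z)" by (cases T') auto
  have eq: "{x, y, z} = {a, b, c}" using assms(1) T T' by simp
  have "x \<noteq> y" "x \<noteq> z" "y \<noteq> z" using noncollinear_distinct[of x y z] assms(2) T eq by simp_all
  moreover have "x \<in> {a, b, c}" "y \<in> {a, b, c}" "z \<in> {a, b, c}"
    unfolding eq[symmetric] by simp_all
  ultimately have "(x, y, z) \<in> {(a, b, c), (b, c, a), (c, a, b), (a, c, b), (c, b, a), (b, a, c)}"
    by blast
  then show ?thesis
    unfolding T T' using area_rotate[of a b c] area_rotate[of b c a] area_rotate[of c b a]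
      area_rotate[of a c b] area_swap[of a b c] by (elim insertE) simp_all
qed

lemma cross3_eq_0_iff_collinear:
  "cross3 (b - a) (c - a) = 0 \<longleftrightarrow> collinear {a, b, c}"
proof -
  have "collinear {a, b, c} \<longleftrightarrow> collinear {b, a, c}" by (simp add: insert_commute)
  also have "\<dots> \<longleftrightarrow> collinear {0, b - a, c - a}" by (rule collinear_3) (simp add: NO_MATCH_def)
  finally show ?thesis by (simp add: cross_eq_0)
qed

lemma area_pos_iff: "area T > 0 \<longleftrightarrow> \<not> collinear (verts T)"
  by (cases T) (auto simp: cross3_eq_0_iff_collinear)

section \<open>Piecewise linear functions and their integrals over a face\<close>

lemma barycentric_unique:
  fixes a b c :: point
  assumes "\<not> collinear {a, b, c}" and "x + y + z = 1" and "x' + y' + z' = 1"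
    and eq: "x *\<^sub>R a + y *\<^sub>R b + z *\<^sub>R c = x' *\<^sub>R a + y' *\<^sub>R b + z' *\<^sub>R c"
  shows "x = x'" "y = y'" "z = z'"
proof -
  have x: "x = 1 - y - z" "x' = 1 - y' - z'" using assms(2,3) by auto
  define u w where "u = b - a" and "w = c - a"
  have bc: "b = a + u" "c = a + w" by (simp_all add: u_def w_def)
  have indep: "cross3 u w \<noteq> 0"
    using assms(1) by (simp add: cross3_eq_0_iff_collinear u_def w_def)
  have *: "(y - y') *\<^sub>R u + (z - z') *\<^sub>R w = 0"
    using eq unfolding x bc by (simp add: algebra_simps)
  \<comment> \<open>Crossing with \<open>w\<close> or \<open>u\<close> kills one summand and
    isolates the coefficient of the other.\<close>
  have "cross3 ((y - y') *\<^sub>R u + (z - z') *\<^sub>R w) w = (y - y') *\<^sub>R cross3 u w"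
    "cross3 u ((y - y') *\<^sub>R u + (z - z') *\<^sub>R w) = (z - z') *\<^sub>R cross3 u w"
    by (simp_all add: cross_add_left cross_add_right cross_mult_left cross_mult_right)
  with * indep show "y = y'" "z = z'" by auto
  then show "x = x'" using x by simp
qed

lemma linear_extension_barycentric:
  assumes "\<not> collinear {a, b, c}" and "x + y + z = 1"
  shows "linear_extension f (a, b, c) (x *\<^sub>R a + y *\<^sub>R b + z *\<^sub>R c) = x * f a + y * f b + z * f c"
  unfolding linear_extension.simps
proof (rule the_equality)
  show "\<exists>x' y' z'. x' + y' + z' = 1 \<and>
      x *\<^sub>R a + y *\<^sub>R b + z *\<^sub>R c = x' *\<^sub>R a + y' *\<^sub>R b + z' *\<^sub>R c \<and>
      x * f a + y * f b + z * f c = x' * f a + y' * f b + z' * f c"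
    using assms by blast
qed (use barycentric_unique[OF assms] in metis)

lemma integral_affine_standard_triangle:
  fixes A B C :: real
  shows "set_lebesgue_integral lborel {(s :: real, t :: real). 0 \<le> s \<and> 0 \<le> t \<and> s + t \<le> 1}
       (\<lambda>(s, t). A + B * s + C * t) = A / 2 + B / 6 + C / 6"
proof -
  define D where "D = {(s :: real, t :: real). 0 \<le> s \<and> 0 \<le> t \<and> s + t \<le> 1}"
  define \<phi> where "\<phi> p = indicator D p *\<^sub>R (case p of (s, t) \<Rightarrow> A + B * s + C * t)" for p
  have "closed D"
  proof -
    have "D = {p. 0 \<le> fst p} \<inter> {p. 0 \<le> snd p} \<inter> {p. fst p + snd p \<le> 1}"
      by (auto simp: D_def)
    then show ?thesis
      by (auto intro!: closed_Int closed_Collect_le continuous_intros)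
  qed
  moreover have "bounded D"
    by (rule bounded_subset[of "{0..1} \<times> {0..1}"]) (auto simp: D_def intro!: bounded_Times)
  ultimately have "compact D" by (simp add: compact_eq_bounded_closed)
  then have int: "integrable lborel \<phi>"
    unfolding \<phi>_def case_prod_beta
    by (rule borel_integrable_compact) (auto intro!: continuous_intros)
  \<comment> \<open>The slice of \<open>D\<close> at \<open>s\<close> is the interval from 0 to
    \<open>1 - s\<close> for \<open>s\<close> in \<open>{0..1}\<close>, and empty otherwise.\<close>
  have inner: "(\<integral>t. \<phi> (s, t) \<partial>lborel) =
      indicator {0..1} s * ((A + B * s) * (1 - s) + C * (1 - s)\<^sup>2 / 2)" for s
  proof (cases "s \<in> {0..1}")
    case True
    have "(\<integral>t. \<phi> (s, t) \<partial>lborel) = (\<integral>t. (A + B * s + C * t) * indicator {0..1 - s} t \<partial>lborel)"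
      by (rule Bochner_Integration.integral_cong)
        (use True in \<open>auto simp: \<phi>_def D_def indicator_def\<close>)
    also have "\<dots> = ((A + B * s) * (1 - s) + C * (1 - s)\<^sup>2 / 2) - ((A + B * s) * 0 + C * 0\<^sup>2 / 2)"
      by (rule integral_FTC_Icc_real)
        (use True in \<open>auto intro!: derivative_eq_intros continuous_intros\<close>)
    finally show ?thesis using True by simp
  next
    case False
    then have "\<phi> (s, t) = 0" for t by (auto simp: \<phi>_def D_def)
    then show ?thesis using False by simp
  qed
  have "set_lebesgue_integral lborel D (\<lambda>(s, t). A + B * s + C * t) = integral\<^sup>L lborel \<phi>"
    by (simp add: set_lebesgue_integral_def \<phi>_def[abs_def])
  also have "\<dots> = (\<integral>s. \<integral>t. \<phi> (s, t) \<partial>lborel \<partial>lborel)"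
    using lborel_pair.integral_fst'[of \<phi>] int by (simp add: lborel_prod)
  also have "\<dots> = (\<integral>s. ((A + B * s) * (1 - s) + C * (1 - s)\<^sup>2 / 2) * indicator {0..1} s \<partial>lborel)"
    by (simp add: inner mult.commute)
  \<comment> \<open>The antiderivative
    \<open>A * s + (B - A) * s^2 / 2 - B * s^3 / 3 - C * (1 - s)^3 / 6\<close> stands unsimplified
    at 1 and 0, so that it can be read off.\<close>
  also have "\<dots> = (A * 1 + (B - A) * 1\<^sup>2 / 2 - B * 1 ^ 3 / 3 - C * (1 - 1) ^ 3 / 6)
      - (A * 0 + (B - A) * 0\<^sup>2 / 2 - B * 0 ^ 3 / 3 - C * (1 - 0) ^ 3 / 6)"
    by (rule integral_FTC_Icc_real)
      (auto intro!: derivative_eq_intros continuous_intros simp: field_simps power2_eq_square)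
  finally show ?thesis by (simp add: D_def field_simps)
qed

lemma face_integral_linear_extension:
  assumes "\<not> collinear (verts T)"
  shows "face_integral T (linear_extension f T) = area T / 3 * (\<Sum>v\<in>verts T. f v)"
proof -
  obtain a b c where T: "T = (a, b, c)" by (cases T) auto
  have ncol: "\<not> collinear {a, b, c}" using assms T by simp
  note distinct = noncollinear_distinct[OF ncol]
  define m where "m = norm (cross3 (b - a) (c - a))"
  have "linear_extension f T (a + s *\<^sub>R (b - a) + t *\<^sub>R (c - a)) * m
      = f a * m + (f b - f a) * m * s + (f c - f a) * m * t" for s t
  proof -
    have "a + s *\<^sub>R (b - a) + t *\<^sub>R (c - a) = (1 - s - t) *\<^sub>R a + s *\<^sub>R b + t *\<^sub>R c"
      by (simp add: algebra_simps)
    then have "linear_extension f T (a + s *\<^sub>R (b - a) + t *\<^sub>R (c - a))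
        = (1 - s - t) * f a + s * f b + t * f c"
      using linear_extension_barycentric[OF ncol, of "1 - s - t" s t f] by (simp only: T)
    then show ?thesis by (simp only:) (simp add: algebra_simps)
  qed
  then have "face_integral T (linear_extension f T)
      = f a * m / 2 + (f b - f a) * m / 6 + (f c - f a) * m / 6"
    unfolding T face_integral.simps
    by (subst integral_affine_standard_triangle[symmetric]) (simp only: T m_def)
  \<comment> \<open>\<open>m\<close> is twice the area, and each vertex value collects the
    coefficient \<open>m / 6\<close>.\<close>
  also have "\<dots> = area T / 3 * (\<Sum>v\<in>verts T. f v)"
    using distinct by (simp add: T m_def field_simps)
  finally show ?thesis .
qed

section \<open>Links and labelled rings\<close>

text \<open>Ordered pairs, so that the edge opposite to \<open>v\<close> appears once for each
  endpoint at which an outer normal is taken. Vertex sets make the relation symmetric in all three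
  points.\<close>

definition link :: "face set \<Rightarrow> point \<Rightarrow> (point \<times> point) set" where
  "link F v = {(x, y). {v, x, y} \<in> verts ` F}"

lemma link_rotate: "(x, y) \<in> link F v \<longleftrightarrow> (v, y) \<in> link F x"
  by (simp add: link_def insert_commute)

lemma surface_mesh_noncollinear:
  assumes "surface_mesh V F" and "S \<in> verts ` F"
  shows "\<not> collinear S"
  using assms by (auto simp: surface_mesh_def)

lemma surface_mesh_link_subset:
  assumes "surface_mesh V F"
  shows "link F v \<subseteq> V \<times> V"
proof (rule subrelI)
  fix x y assume "(x, y) \<in> link F v"
  then obtain T where "T \<in> F" "verts T = {v, x, y}" by (auto simp: link_def)
  then have "{v, x, y} \<subseteq> V" using assms by (auto simp: surface_mesh_def)
  then show "(x, y) \<in> V \<times> V" by simp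
qed

locale labelled_ring =
  fixes V :: "point set" and F :: "face set" and v :: point and n :: nat and p :: "nat \<Rightarrow> point"
  assumes mesh: "surface_mesh V F" and valence: "n \<ge> 3" and ring: "ring_labelling F v n p"
begin

lemma p_eq_iff:
  assumes "i < n" "j < n"
  shows "p i = p j \<longleftrightarrow> i = j"
  using ring assms by (auto simp: ring_labelling_def bij_betw_def inj_on_def)

lemma p_Suc_eq_iff:
  assumes "i < n" "j < n"
  shows "p (Suc i) = p (Suc j) \<longleftrightarrow> i = j"
    and "p i = p (Suc j) \<longleftrightarrow> i = Suc j \<or> i = 0 \<and> Suc j = n"
proof -
  have "p n = p 0" using ring by (simp add: ring_labelling_def)
  \<comment> \<open>Indices are reduced modulo \<open>n\<close> to the range on which
    \<open>p\<close> is injective.\<close>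
  then have wrap: "p (Suc k) = p (if Suc k = n then 0 else Suc k)" for k by simp
  show "p (Suc i) = p (Suc j) \<longleftrightarrow> i = j"
    unfolding wrap[of i] wrap[of j] by (subst p_eq_iff) (use assms in auto)
  show "p i = p (Suc j) \<longleftrightarrow> i = Suc j \<or> i = 0 \<and> Suc j = n"
    unfolding wrap[of j] by (subst p_eq_iff) (use assms in auto)
qed

text \<open>A reversal would force \<open>i = j + 1\<close> and \<open>j = i + 1\<close> modulo
  \<open>n\<close>, so \<open>n\<close> would divide 2. Hence the two orders of the ring edges never
  collide in \<open>sum_link\<close>.\<close>

lemma edge_not_reversed:
  assumes "i < n" "j < n"
  shows "\<not> (p i = p (Suc j) \<and> p (Suc i) = p j)"
proof
  assume eq: "p i = p (Suc j) \<and> p (Suc i) = p j"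
  have "i = Suc j \<or> i = 0 \<and> Suc j = n" using p_Suc_eq_iff(2)[OF assms] eq by blast
  moreover have "j = Suc i \<or> j = 0 \<and> Suc i = n"
    using p_Suc_eq_iff(2)[OF assms(2,1)] eq by metis
  ultimately show False using valence by linarith
qed

lemma triangles_at: "verts ` star F v = (\<lambda>j. {v, p j, p (Suc j)}) ` {..<n}"
  using ring by (simp add: ring_labelling_def)

lemma triangle_at:
  assumes "j < n"
  shows "{v, p j, p (Suc j)} \<in> verts ` F"
  proof -
  have "{v, p j, p (Suc j)} \<in> verts ` star F v" unfolding triangles_at using assms by blast
  then show ?thesis by (auto simp: star_def)
qed

lemma noncollinear_at: "j < n \<Longrightarrow> \<not> collinear {v, p j, p (Suc j)}"
  using surface_mesh_noncollinear[OF mesh triangle_at] .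

lemma triangle_at_distinct:
  assumes "j < n"
  shows "v \<noteq> p j" "v \<noteq> p (Suc j)" "p j \<noteq> p (Suc j)"
  using noncollinear_distinct[OF noncollinear_at[OF assms]] by auto

text \<open>A face through \<open>v\<close> belongs to the ring; removing \<open>v\<close> from its
  vertex set leaves a ring edge, in either order.\<close>

lemma link_eq:
  "link F v = (\<lambda>j. (p j, p (Suc j))) ` {..<n} \<union> (\<lambda>j. (p (Suc j), p j)) ` {..<n}"
proof (intro equalityI subrelI)
  fix x y assume "(x, y) \<in> link F v"
  then have xy: "{v, x, y} \<in> verts ` F" by (simp add: link_def)
  then have "{v, x, y} \<in> verts ` star F v" by (force simp: star_def)
  then obtain j where j: "j < n" "{v, x, y} = {v, p j, p (Suc j)}"
    unfolding triangles_at by auto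
  then have "{x, y} = {p j, p (Suc j)}"
    using noncollinear_distinct[OF surface_mesh_noncollinear[OF mesh xy]]
      triangle_at_distinct[OF j(1)]
    by (simp add: insert_ident)
  then show "(x, y) \<in> (\<lambda>j. (p j, p (Suc j))) ` {..<n} \<union> (\<lambda>j. (p (Suc j), p j)) ` {..<n}"
    using j(1) by (auto simp: doubleton_eq_iff)
next
  fix x y assume "(x, y) \<in> (\<lambda>j. (p j, p (Suc j))) ` {..<n} \<union> (\<lambda>j. (p (Suc j), p j)) ` {..<n}"
  then show "(x, y) \<in> link F v"
    using triangle_at by (auto simp: link_def insert_commute)
qed

lemma sum_link:
  fixes \<phi> :: "point \<Rightarrow> point \<Rightarrow> real"
  shows "(\<Sum>(x, y)\<in>link F v. \<phi> x y) = (\<Sum>j<n. \<phi> (p j) (p (Suc j)) + \<phi> (p (Suc j)) (p j))"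
proof -
  have disj: "(\<lambda>j. (p j, p (Suc j))) ` {..<n} \<inter> (\<lambda>j. (p (Suc j), p j)) ` {..<n} = {}"
    using edge_not_reversed by auto
  have inj: "inj_on (\<lambda>j. (p j, p (Suc j))) {..<n}" "inj_on (\<lambda>j. (p (Suc j), p j)) {..<n}"
    by (auto simp: inj_on_def p_eq_iff)
  show ?thesis
    unfolding link_eq
    by (subst sum.union_disjoint) (auto simp: disj sum.reindex inj sum.distrib)
qed

text \<open>Both sums run over the vertex sets of the triangles at \<open>v\<close>;
  \<open>\<tau>\<close> recovers the face from its vertex set.\<close>

lemma sum_area:
  "(\<Sum>k<n. area (v, p k, p (Suc k))) = (\<Sum>T\<in>star F v. area T)"
proof -
  have inj: "inj_on verts (star F v)"
    using mesh by (auto simp: surface_mesh_def star_def intro: inj_on_subset)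
  have inj': "inj_on (\<lambda>k. {v, p k, p (Suc k)}) {..<n}"
  proof (rule inj_onI, simp)
    fix i j assume ij: "i < n" "j < n" "{v, p i, p (Suc i)} = {v, p j, p (Suc j)}"
    have "{p i, p (Suc i)} = {p j, p (Suc j)}"
      using ij(3) triangle_at_distinct[OF ij(1)] triangle_at_distinct[OF ij(2)]
      by (simp add: insert_ident)
    then have "p i = p j \<or> p i = p (Suc j) \<and> p (Suc i) = p j"
      by (auto simp: doubleton_eq_iff)
    then show "i = j"
      using p_eq_iff[OF ij(1,2)] edge_not_reversed[OF ij(1,2)] by blast
  qed
  define \<tau> where "\<tau> = the_inv_into (star F v) verts"
  have "(\<Sum>T\<in>star F v. area T) = (\<Sum>S\<in>verts ` star F v. area (\<tau> S))"
    by (simp add: sum.reindex inj \<tau>_def the_inv_into_f_f)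
  also have "\<dots> = (\<Sum>k<n. area (\<tau> {v, p k, p (Suc k)}))"
    unfolding triangles_at by (simp add: sum.reindex inj')
  also have "\<dots> = (\<Sum>k<n. area (v, p k, p (Suc k)))"
  proof (rule sum.cong[OF refl], rule area_eq_if_verts_eq)
    fix k assume k: "k \<in> {..<n}"
    then have "{v, p k, p (Suc k)} \<in> verts ` star F v" unfolding triangles_at by blast
    then show eq: "verts (\<tau> {v, p k, p (Suc k)}) = verts (v, p k, p (Suc k))"
      unfolding \<tau>_def by (simp add: f_the_inv_into_f[OF inj])
    show "\<not> collinear (verts (\<tau> {v, p k, p (Suc k)}))"
      using noncollinear_at k unfolding eq by simp
  qed
  finally show ?thesis ..
qed

lemma sum_area_pos: "(\<Sum>T\<in>star F v. area T) > 0"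
proof (rule sum_pos)
  show "finite (star F v)" using mesh by (simp add: surface_mesh_def star_def)
  show "star F v \<noteq> {}" using triangles_at valence by (auto simp: lessThan_empty_iff)
  show "area T > 0" if "T \<in> star F v" for T
    using mesh that by (simp add: area_pos_iff surface_mesh_def star_def)
qed

end

section \<open>Outer normals and fluxes\<close>

text \<open>When nonzero, this is the projected edge at \<open>a\<close>, turned clockwise by a
  right angle in the approximate tangent plane and normalised. No third vertex enters.\<close>

definition conormal :: "face set \<Rightarrow> point \<Rightarrow> point \<Rightarrow> point" where
  "conormal F a b = sgn (cross3 (proj_A F a (b - a)) (normal_A F a))"

text \<open>The numerator of the outer normal is \<open>w1 \<times> (w1 \<times> w2)\<close>. Since \<open>w1 \<times> w2\<close> is a multiple \<open>d\<close> of the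
  normal, the outer normal depends on the opposite vertex \<open>v\<close> only through the sign of \<open>d\<close>.\<close>
lemma outer_normal_eq_conormal:
  assumes "cross3 (proj_A F a (b - a)) (proj_A F a (v - a)) = d *\<^sub>R normal_A F a"
  shows "outer_normal F v a b = sgn d *\<^sub>R conormal F a b"
proof -
  let ?w1 = "proj_A F a (b - a)" and ?w2 = "proj_A F a (v - a)"
  have "outer_vec F v a b = cross3 ?w1 (cross3 ?w1 ?w2)"
    by (simp add: outer_vec_def Let_def Lagrange power2_norm_eq_inner inner_commute)
  also have "\<dots> = d *\<^sub>R cross3 ?w1 (normal_A F a)"
    by (simp add: assms cross_mult_right)
  finally show ?thesis
    by (simp add: outer_normal_def conormal_def sgn_scaleR sgn_div_norm divide_inverse)
qed

text \<open>In polar coordinates the factor is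
  \<open>r j * r (Suc j) * sin (\<theta> (Suc j) - \<theta> j)\<close>, positive since the angle
  step lies between 0 and \<open>pi\<close>.\<close>

lemma ccw_once_cross3:
  assumes "ccw_once N n q" "j < n"
  shows "\<exists>d>0. cross3 (q j) (q (Suc j)) = d *\<^sub>R N"
proof -
  obtain f1 f2 r \<theta> where f: "cross3 f1 f2 = N"
    and r: "\<And>j. j \<le> n \<Longrightarrow> r j > 0 \<and> q j = r j *\<^sub>R (cos (\<theta> j) *\<^sub>R f1 + sin (\<theta> j) *\<^sub>R f2)"
    and \<theta>: "\<And>j. j < n \<Longrightarrow> 0 < \<theta> (Suc j) - \<theta> j \<and> \<theta> (Suc j) - \<theta> j < pi"
    using assms(1) unfolding ccw_once_def by blast
  have "cross3 (q j) (q (Suc j)) = (r j * r (Suc j) * sin (\<theta> (Suc j) - \<theta> j)) *\<^sub>R N"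
  proof -
    have "cross3 f2 f1 = - N" using f by (metis cross_skew)
    then show ?thesis
      using r[of j] r[of "Suc j"] assms(2) f
      by (simp add: cross_add_left cross_add_right cross_mult_left cross_mult_right sin_diff
          algebra_simps)
  qed
  moreover have "r j * r (Suc j) * sin (\<theta> (Suc j) - \<theta> j) > 0"
    using r[of j] r[of "Suc j"] \<theta>[of j] assms(2) by (simp add: sin_gt_zero)
  ultimately show ?thesis by blast
qed

text \<open>Seen from \<open>v\<close>, the third vertex \<open>p (Suc j)\<close> lies
  counterclockwise of the edge to \<open>p j\<close>, while \<open>p j\<close> lies clockwise of the
  edge to \<open>p (Suc j)\<close>; hence the opposite signs.\<close>

lemma (in labelled_ring) outer_normal_ring:
  assumes "j < n"
  shows "outer_normal F (p (Suc j)) v (p j) = conormal F v (p j)"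
    and "outer_normal F (p j) v (p (Suc j)) = - conormal F v (p (Suc j))"
proof -
  let ?q = "\<lambda>j. proj_A F v (p j - v)"
  have "ccw_once (normal_A F v) n ?q" using ring by (simp add: ring_labelling_def)
  then obtain d where d: "d > 0" "cross3 (?q j) (?q (Suc j)) = d *\<^sub>R normal_A F v"
    using ccw_once_cross3[OF _ assms] by blast
  then show "outer_normal F (p (Suc j)) v (p j) = conormal F v (p j)"
    using outer_normal_eq_conormal[OF d(2)] by simp
  have "cross3 (?q (Suc j)) (?q j) = (- d) *\<^sub>R normal_A F v"
    using d(2) by (metis cross_skew scaleR_minus_left)
  from outer_normal_eq_conormal[OF this]
  show "outer_normal F (p j) v (p (Suc j)) = - conormal F v (p (Suc j))"
    using d(1) by simp
qed

text \<open>The share of the endpoint \<open>a\<close>: the terms in the summand of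
  \<open>Div_A\<close> that contain the outer normal at \<open>a\<close>. The share of
  \<open>b\<close> is \<open>flux F X v b a\<close>.\<close>

definition flux :: "face set \<Rightarrow> (point \<Rightarrow> point) \<Rightarrow> point \<Rightarrow> point \<Rightarrow> point \<Rightarrow> real" where
  "flux F X v a b = norm (b - a) / 6 * ((2 *\<^sub>R X a + X b) \<bullet> outer_normal F v a b)"

lemma (in labelled_ring) Div_A_times_area:
  assumes "val v = n" "nb v = p"
  shows "(\<Sum>T\<in>star F v. area T) * Div_A F val nb X v = (\<Sum>(a, b)\<in>link F v. flux F X v a b)"
proof -
  have "(\<Sum>T\<in>star F v. area T) * Div_A F val nb X v
      = (\<Sum>j<n. let a = p j; b = p (Suc j); na = outer_normal F v a b; nb' = outer_normal F v b a
        in norm (b - a) / 6 * (2 * (X a \<bullet> na) + 2 * (X b \<bullet> nb') + X a \<bullet> nb' + X b \<bullet> na))"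
    using sum_area_pos unfolding Div_A_def assms sum_area by simp
  also have "\<dots> = (\<Sum>j<n. flux F X v (p j) (p (Suc j)) + flux F X v (p (Suc j)) (p j))"
  proof (rule sum.cong[OF refl])
    fix j
    have "norm (p j - p (Suc j)) = norm (p (Suc j) - p j)" by (rule norm_minus_commute)
    then show "(let a = p j; b = p (Suc j); na = outer_normal F v a b; nb' = outer_normal F v b a
        in norm (b - a) / 6 * (2 * (X a \<bullet> na) + 2 * (X b \<bullet> nb') + X a \<bullet> nb' + X b \<bullet> na))
        = flux F X v (p j) (p (Suc j)) + flux F X v (p (Suc j)) (p j)"
      by (simp add: flux_def Let_def inner_add_left distrib_left mult.commute)
  qed
  finally show ?thesis unfolding sum_link .
qed

text \<open>Each edge at \<open>v\<close> occurs once with either of its two faces, with opposite outer normals, so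
  that the sum over the ring telescopes.\<close>
lemma (in labelled_ring) sum_flux_at_vertex:
  "(\<Sum>(x, y)\<in>link F v. flux F X x v y) = 0"
proof -
  define c where "c b = norm (b - v) / 6 * ((2 *\<^sub>R X v + X b) \<bullet> conormal F v b)" for b
  have "(\<Sum>(x, y)\<in>link F v. flux F X x v y) = (\<Sum>j<n. c (p j) - c (p (Suc j)))"
    unfolding sum_link
    by (rule sum.cong) (simp_all add: flux_def outer_normal_ring c_def)
  also have "\<dots> = c (p 0) - c (p n)" by (rule sum_lessThan_telescope')
  also have "\<dots> = 0" using ring by (simp add: ring_labelling_def)
  finally show ?thesis .
qed

theorem theorem5:
  fixes V :: "point set" and F :: "face set"
    and val :: "point \<Rightarrow> nat" and nb :: "point \<Rightarrow> nat \<Rightarrow> point"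
    and e1 e2 :: "point \<Rightarrow> point" and \<alpha> \<beta> :: "point \<Rightarrow> nat \<Rightarrow> real"
    and h :: "point \<Rightarrow> real"
  assumes mesh: "surface_mesh V F"
    and closed: "without_boundary F"
    and normal_defined: "\<And>v. v \<in> V \<Longrightarrow> weighted_normal F v \<noteq> 0"
    and valence: "\<And>v. v \<in> V \<Longrightarrow> val v \<ge> 5"
    and labelling: "\<And>v. v \<in> V \<Longrightarrow> ring_labelling F v (val v) (nb v)"
    and outer_defined: "\<And>v j. v \<in> V \<Longrightarrow> j < val v \<Longrightarrow>
      outer_vec F v (nb v j) (nb v (Suc j)) \<noteq> 0 \<and> outer_vec F v (nb v (Suc j)) (nb v j) \<noteq> 0"
    and basis: "\<And>v. v \<in> V \<Longrightarrow> orthonormal_basis_A F v (e1 v) (e2 v)"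
    and coeffs_\<alpha>: "\<And>v. v \<in> V \<Longrightarrow> gradient_coeffs F v (val v) (nb v) (e1 v) (e2 v) (\<alpha> v)"
    and coeffs_\<beta>: "\<And>v. v \<in> V \<Longrightarrow> gradient_coeffs F v (val v) (nb v) (e1 v) (e2 v) (\<beta> v)"
    and invertible: "\<And>v. v \<in> V \<Longrightarrow>
      invertible (gradient_matrix F v (val v) (nb v) (e1 v) (e2 v) (\<alpha> v) (\<beta> v))"
  shows "surface_integral F (linear_extension (laplace_A F val nb e1 e2 \<alpha> \<beta> h)) = 0"
proof -
  define X where "X = gradient_A F val nb e1 e2 \<alpha> \<beta> h"
  let ?L = "Div_A F val nb X"
  have fin: "finite V" "finite F" using mesh by (simp_all add: surface_mesh_def)
  have ring: "labelled_ring V F v (val v) (nb v)" if "v \<in> V" for v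
    using mesh valence[OF that] labelling[OF that] by unfold_locales auto
  have fin_link: "finite (link F v)" for v
    using fin surface_mesh_link_subset[OF mesh] by (meson finite_SigmaI finite_subset)
  have "surface_integral F (linear_extension ?L) = (\<Sum>T\<in>F. area T / 3 * (\<Sum>v\<in>verts T. ?L v))"
    unfolding surface_integral_def
    using mesh by (intro sum.cong refl face_integral_linear_extension) (simp add: surface_mesh_def)
  \<comment> \<open>Writing \<open>verts T\<close> as a subset of \<open>V\<close> prepares the
    exchange of sums, after which each \<open>v\<close> carries the total area of its star.\<close>
  also have "\<dots> = (\<Sum>T\<in>F. \<Sum>v | v \<in> V \<and> v \<in> verts T. area T * ?L v / 3)"
  proof (rule sum.cong[OF refl])
    fix T assume "T \<in> F"
    then have "{v. v \<in> V \<and> v \<in> verts T} = verts T" using mesh by (auto simp: surface_mesh_def)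
    then show "area T / 3 * (\<Sum>v\<in>verts T. ?L v)
        = (\<Sum>v | v \<in> V \<and> v \<in> verts T. area T * ?L v / 3)"
      by (simp add: sum_distrib_left)
  qed
  also have "\<dots> = (\<Sum>v\<in>V. \<Sum>T | T \<in> F \<and> v \<in> verts T. area T * ?L v / 3)"
    by (rule sum.swap_restrict) (use fin in auto)
  also have "\<dots> = (\<Sum>v\<in>V. (\<Sum>T\<in>star F v. area T) * ?L v) / 3"
    by (simp add: star_def sum_distrib_right sum_divide_distrib)
  also have "(\<Sum>v\<in>V. (\<Sum>T\<in>star F v. area T) * ?L v) = (\<Sum>v\<in>V. \<Sum>(a, b)\<in>link F v. flux F X v a b)"
    using labelled_ring.Div_A_times_area[OF ring] by simp
  also have "\<dots> = (\<Sum>(v, a, b)\<in>Sigma V (link F). flux F X v a b)"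
    using fin fin_link by (subst sum.Sigma) auto
  \<comment> \<open>Swapping the first two entries maps the index set onto itself by
    \<open>link_rotate\<close>. Fluxes are now collected by the vertex \<open>a\<close> at which the
    outer normal is taken.\<close>
  also have "\<dots> = (\<Sum>(a, v, b)\<in>Sigma V (link F). flux F X v a b)"
    by (rule sum.reindex_bij_witness[of _ "\<lambda>(a, v, b). (v, a, b)" "\<lambda>(v, a, b). (a, v, b)"])
      (use surface_mesh_link_subset[OF mesh] link_rotate in auto)
  also have "\<dots> = (\<Sum>a\<in>V. \<Sum>(v, b)\<in>link F a. flux F X v a b)"
    using fin fin_link by (subst sum.Sigma) auto
  also have "\<dots> = 0"
    using labelled_ring.sum_flux_at_vertex[OF ring] by simp
  finally show ?thesis by (simp add: laplace_A_def[abs_def] X_def)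
qed

end
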